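(* Let $\mathbb{F}_q$ be a finite field of odd characteristic with $q>5$ elements. For any $a,b\in\mathbb{F}_q$ and for all integers $t$ with $3\le t\le q-2$, there exist pairwise distinct elements $X_1,\dots,X_t\in\mathbb{F}_q$ such that $$b=\sum_{1\le i<j\le t}X_iX_j+\sum_{i=1}^{t}X_i^2-a\sum_{i=1}^{t}X_i.$$ *)

theory Defs
  imports "HOL-Number_Theory.Number_Theory" "HOL-Library.Cardinality"
begin

end

(*
  Doubling the equation turns it into p2(S) + (e1(S) - a)^2 = 2b + a^2 for the t-subset S of
  values, where e1 and p2 are the sums of the elements and of their squares.

  If 2t >= q, write the complement of S as B + {x, y} with B fixed: the equation becomes
  (x + s)(y + s) = d, a hyperbola with too many points to be blocked by B.

  If 2t < q, translate. When t = 0, or t = -1 and a is nonzero, in the field, translating any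
  (suitable) S changes the left-hand side by an arbitrary amount. When t is neither 0 nor -1,
  take S symmetric about a centre u, so that e1 is known and p2 is a sum of squares; replacing
  one pair +-r and moving u leaves a conic in r and u, which has at least q - 1 points. The case
  t = 3 with right-hand side 0 escapes this because the conic degenerates.

  There remains t = -1, a = 0, where translations do nothing. Nonzero values come from symmetric
  sets by rescaling. In characteristic > 3, a set invariant under x -> x + 1 has e1 = p2 = 0,
  and deleting one point of such a set gives the value 0. In characteristic 3 each coset of the
  prime field adds 2 to the value, and a five-element family takes all values.
*)

theory Submission
  imports Defs
begin

section \<open>Points on conics\<close>

definition nonzero_squares :: "'a :: field set" where
  "nonzero_squares = (\<lambda>x. x\<^sup>2) ` (- {0})"

lemma card_square_eq_le:
  fixes c \<beta> :: "'a :: {field, finite}"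
  assumes "\<beta> \<noteq> 0"
  shows "card {x. \<beta> * x\<^sup>2 = c} \<le> 2"
proof (cases "\<exists>y. \<beta> * y\<^sup>2 = c")
  case True
  then obtain y where y: "\<beta> * y\<^sup>2 = c" ..
  have "{x. \<beta> * x\<^sup>2 = c} \<subseteq> {y, -y}"
    using assms y by (auto simp: power2_eq_iff)
  then have "card {x. \<beta> * x\<^sup>2 = c} \<le> card {y, -y}"
    by (intro card_mono) auto
  also have "\<dots> \<le> 2"
    by (simp add: card_insert_if)
  finally show ?thesis .
qed simp

text \<open>Every nonzero square has two distinct roots \<open>r\<close>, \<open>-r\<close>. Sets
  symmetric about 0 are thus encoded by sets of nonzero squares, with size and sum of squares read
  off \<open>A\<close>.\<close>

lemma sqrt_set:
  fixes A :: "'a :: {field, finite} set"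
  assumes "(2 :: 'a) \<noteq> 0" and "A \<subseteq> nonzero_squares"
  shows "card {x. x\<^sup>2 \<in> A} = 2 * card A \<and> (\<Sum>x | x\<^sup>2 \<in> A. x\<^sup>2) = 2 * \<Sum>A"
proof -
  have "finite A" by simp
  then show ?thesis using assms(2)
  proof (induction A rule: finite_induct)
    case (insert a A)
    obtain r where r: "r \<noteq> 0" "r\<^sup>2 = a"
      using insert.prems by (auto simp: nonzero_squares_def)
    have eq: "{x. x\<^sup>2 \<in> insert a A} = insert r (insert (-r) {x. x\<^sup>2 \<in> A})"
      using r by (auto simp: power2_eq_iff)
    have "r \<noteq> -r"
      using r assms(1) by (metis add.inverse_inverse eq_neg_iff_add_eq_0 mult_2 no_zero_divisors)
    moreover have "r \<notin> {x. x\<^sup>2 \<in> A}" "-r \<notin> {x. x\<^sup>2 \<in> A}"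
      using r insert.hyps by auto
    ultimately show ?case
      unfolding eq using insert r by (simp add: algebra_simps)
  qed auto
qed

text \<open>Negation permutes the set, so the sum is its own negative. With \<open>A = UNIV\<close>
  this is the sum over the whole field.\<close>

lemma sum_sqrt_set:
  fixes A :: "'a :: {field, finite} set"
  assumes "(2 :: 'a) \<noteq> 0"
  shows "(\<Sum>x | x\<^sup>2 \<in> A. x) = 0"
proof -
  have "(\<Sum>x | x\<^sup>2 \<in> A. x) = (\<Sum>x | x\<^sup>2 \<in> A. -x)"
    by (rule sum.reindex_bij_witness[of _ uminus uminus]) auto
  then have "(\<Sum>x | x\<^sup>2 \<in> A. x) + (\<Sum>x | x\<^sup>2 \<in> A. x) = 0"
    unfolding sum_negf eq_neg_iff_add_eq_0 .
  then have "2 * (\<Sum>x | x\<^sup>2 \<in> A. x) = 0" by (simp only: mult_2)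
  then show ?thesis using assms by simp
qed

lemma card_nonzero_squares:
  assumes "(2 :: 'a :: {field, finite}) \<noteq> 0"
  shows "CARD('a) = 2 * card (nonzero_squares :: 'a set) + 1"
proof -
  have "{x :: 'a. x\<^sup>2 \<in> nonzero_squares} = UNIV - {0}"
    by (auto simp: nonzero_squares_def)
  then have "card (UNIV - {0 :: 'a}) = 2 * card (nonzero_squares :: 'a set)"
    using sqrt_set[OF assms order.refl] by simp
  moreover have "CARD('a) > 0" by (simp add: card_gt_0_iff)
  ultimately show ?thesis
    by (simp add: card_Diff_singleton del: zero_less_card_finite)
qed

text \<open>Pigeonhole: \<open>\<alpha> * r^2\<close> and \<open>d - \<beta> * v^2\<close> each take
  (q + 1)/2 values, so they share one.\<close>

lemma conic_has_point:
  fixes \<alpha> \<beta> d :: "'a :: {field, finite}"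
  assumes two: "(2 :: 'a) \<noteq> 0" and "\<alpha> \<noteq> 0" "\<beta> \<noteq> 0"
  shows "\<exists>r v. \<alpha> * r\<^sup>2 + \<beta> * v\<^sup>2 = d"
proof -
  let ?S = "insert 0 nonzero_squares :: 'a set"
  have S: "?S = range (\<lambda>x. x\<^sup>2)"
    by (auto simp: nonzero_squares_def image_iff)
  have "0 \<notin> (nonzero_squares :: 'a set)" by (auto simp: nonzero_squares_def)
  then have S_card: "2 * card ?S > CARD('a)"
    using card_nonzero_squares[OF two] by simp
  define X where "X = (\<lambda>x. \<alpha> * x) ` ?S"
  define Y where "Y = (\<lambda>x. d - \<beta> * x) ` ?S"
  have "card X = card ?S" "card Y = card ?S"
    unfolding X_def Y_def using assms by (intro card_image inj_onI; simp)+
  moreover have "card (X \<union> Y) \<le> CARD('a)" by (rule card_mono) auto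
  moreover have "card X + card Y = card (X \<union> Y) + card (X \<inter> Y)"
    by (rule card_Un_Int) auto
  ultimately have "X \<inter> Y \<noteq> {}" using S_card by auto
  then obtain z where "z \<in> X" "z \<in> Y" by blast
  then obtain r v where "z = \<alpha> * r\<^sup>2" "z = d - \<beta> * v\<^sup>2"
    unfolding X_def Y_def S by blast
  then have "\<alpha> * r\<^sup>2 + \<beta> * v\<^sup>2 = d" by (metis diff_add_cancel)
  then show ?thesis by blast
qed

text \<open>The affine conic is parametrised by the slopes of the lines through one of its points.\<close>

lemma card_conic_ge:
  fixes \<alpha> \<beta> d :: "'a :: {field, finite}"
  assumes two: "(2 :: 'a) \<noteq> 0" and nz: "\<alpha> \<noteq> 0" "\<beta> \<noteq> 0" "d \<noteq> 0"
  shows "CARD('a) - 1 \<le> card {(r, v). \<alpha> * r\<^sup>2 + \<beta> * v\<^sup>2 = d}"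
proof -
  obtain r v where rv: "\<alpha> * r\<^sup>2 + \<beta> * v\<^sup>2 = d"
    using conic_has_point[OF two nz(1,2)] by blast
  define P where "P = {(r, v). \<alpha> * r\<^sup>2 + \<beta> * v\<^sup>2 = d}"
  \<comment> \<open>\<open>l m\<close> is the second root, besides 0, of the conic's equation on the
    line of slope \<open>m\<close> through \<open>(r, v)\<close>. The slopes in \<open>N\<close>
    make that equation lose its quadratic term; those in \<open>Z\<close> make its linear term
    vanish, as for a tangent.\<close>
  define l where "l m = - (2 * (\<alpha> * r + \<beta> * v * m)) / (\<alpha> + \<beta> * m\<^sup>2)" for m
  define g where "g m = (r + l m, v + m * l m)" for m
  define N where "N = {m. \<beta> * m\<^sup>2 = - \<alpha>}"
  define Z where "Z = {m. \<alpha> * r + \<beta> * v * m = 0}"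
  define D where "D = - (N \<union> Z)"
  have l_nz: "l m \<noteq> 0" if "m \<in> D" for m
  proof -
    have "\<alpha> + \<beta> * m\<^sup>2 \<noteq> 0" "\<alpha> * r + \<beta> * v * m \<noteq> 0"
      using that by (auto simp: D_def N_def Z_def add_eq_0_iff)
    then show ?thesis
      using two by (simp add: l_def del: distrib_left_numeral)
  qed
  have "inj_on g D"
    using l_nz by (auto simp: inj_on_def g_def)
  then have card_g: "card (g ` D) = card D" by (rule card_image)
  have on_conic: "g m \<in> P" if "m \<in> D" for m
  proof -
    have "\<alpha> + \<beta> * m\<^sup>2 \<noteq> 0"
      using that by (auto simp: D_def N_def add_eq_0_iff)
    then have "l m * (\<alpha> + \<beta> * m\<^sup>2) = - (2 * (\<alpha> * r + \<beta> * v * m))"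
      by (simp add: l_def)
    moreover have "\<alpha> * (r + l m)\<^sup>2 + \<beta> * (v + m * l m)\<^sup>2 =
        \<alpha> * r\<^sup>2 + \<beta> * v\<^sup>2 + l m * (l m * (\<alpha> + \<beta> * m\<^sup>2) + 2 * (\<alpha> * r + \<beta> * v * m))"
      by (simp add: power2_eq_square algebra_simps)
    ultimately show ?thesis using rv by (simp add: g_def P_def)
  qed
  have "g ` D \<inter> {(r, v), (r, -v)} = {}"
    using l_nz by (auto simp: g_def)
  moreover have "(r, v) \<in> P" "(r, -v) \<in> P"
    using rv by (auto simp: P_def)
  then have "g ` D \<union> {(r, v), (r, -v)} \<subseteq> P"
    using on_conic by blast
  ultimately have "card (g ` D) + card {(r, v), (r, -v)} \<le> card P"
    by (metis card_Un_disjoint card_mono finite)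
  moreover have "card N \<le> 2" unfolding N_def using nz by (intro card_square_eq_le)
  \<comment> \<open>The points \<open>(r, v)\<close> and \<open>(r, -v)\<close> of the vertical line
    are missed by \<open>g\<close> and make up for the slopes lost to \<open>Z\<close>: they
    coincide only if \<open>v = 0\<close>, and then \<open>Z\<close> is empty. Only the at most two
    slopes in \<open>N\<close> remain to be paid for, which leaves q - 2 + 1 points.\<close>
  moreover have "card Z + 1 \<le> card {(r, v), (r, -v)}"
  proof (cases "v = 0")
    case True
    then have "r \<noteq> 0" using rv nz by auto
    with True have "Z = {}" using nz by (auto simp: Z_def)
    then show ?thesis by (simp add: card_insert_if)
  next
    case False
    have "Z \<subseteq> {- (\<alpha> * r) / (\<beta> * v)}"
      using False nz by (auto simp: Z_def field_simps add_eq_0_iff)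
    then have "card Z \<le> card {- (\<alpha> * r) / (\<beta> * v)}" by (rule card_mono[rotated]) simp
    moreover have "v \<noteq> -v"
      using False two by (metis eq_neg_iff_add_eq_0 mult_2 no_zero_divisors)
    ultimately show ?thesis by simp
  qed
  moreover have "card D = CARD('a) - card (N \<union> Z)"
    unfolding D_def by (simp add: Compl_eq_Diff_UNIV card_Diff_subset)
  moreover have "card (N \<union> Z) \<le> card N + card Z" by (rule card_Un_le)
  ultimately show ?thesis unfolding P_def[symmetric] card_g by linarith
qed

text \<open>Forbidding one value of a coordinate fixes the square of the other, so it costs at most
  two of the q - 1 points.\<close>

lemma conic_avoid:
  fixes \<alpha> \<beta> d :: "'a :: {field, finite}"
  assumes two: "(2 :: 'a) \<noteq> 0" and nz: "\<alpha> \<noteq> 0" "\<beta> \<noteq> 0" "d \<noteq> 0"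
    and few: "2 * card R + 2 * card V + 1 < CARD('a)"
  shows "\<exists>r v. \<alpha> * r\<^sup>2 + \<beta> * v\<^sup>2 = d \<and> r \<notin> R \<and> v \<notin> V"
proof (rule ccontr)
  assume none: "\<not> ?thesis"
  let ?R = "\<lambda>r. Pair r ` {v. \<beta> * v\<^sup>2 = d - \<alpha> * r\<^sup>2}"
  let ?V = "\<lambda>v. (\<lambda>r. (r, v)) ` {r. \<alpha> * r\<^sup>2 = d - \<beta> * v\<^sup>2}"
  have "p \<in> (\<Union>r\<in>R. ?R r) \<union> (\<Union>v\<in>V. ?V v)"
    if p_on: "p \<in> {(r, v). \<alpha> * r\<^sup>2 + \<beta> * v\<^sup>2 = d}" for p
  proof -
    obtain r v where p: "p = (r, v)" and on: "\<alpha> * r\<^sup>2 + \<beta> * v\<^sup>2 = d"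
      using p_on by blast
    have "\<alpha> * r\<^sup>2 = d - \<beta> * v\<^sup>2" "\<beta> * v\<^sup>2 = d - \<alpha> * r\<^sup>2"
      using on by (simp_all add: eq_diff_eq add.commute)
    moreover have "r \<in> R \<or> v \<in> V" using none on by blast
    ultimately show ?thesis unfolding p by blast
  qed
  then have "CARD('a) - 1 \<le> card ((\<Union>r\<in>R. ?R r) \<union> (\<Union>v\<in>V. ?V v))"
    using card_conic_ge[OF two nz] by (meson card_mono finite le_trans subsetI)
  moreover have "card ((\<Union>r\<in>R. ?R r) \<union> (\<Union>v\<in>V. ?V v)) \<le>
      card (\<Union>r\<in>R. ?R r) + card (\<Union>v\<in>V. ?V v)" by (rule card_Un_le)
  moreover have "card (\<Union>r\<in>R. ?R r) \<le> (\<Sum>r\<in>R. card (?R r))"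
    by (intro card_UN_le) simp
  moreover have "(\<Sum>r\<in>R. card (?R r)) \<le> (\<Sum>r\<in>R. 2)"
    using nz by (intro sum_mono order.trans[OF card_image_le card_square_eq_le]) auto
  moreover have "card (\<Union>v\<in>V. ?V v) \<le> (\<Sum>v\<in>V. card (?V v))"
    by (intro card_UN_le) simp
  moreover have "(\<Sum>v\<in>V. card (?V v)) \<le> (\<Sum>v\<in>V. 2)"
    using nz by (intro sum_mono order.trans[OF card_image_le card_square_eq_le]) auto
  ultimately show False using few by simp
qed

text \<open>Two \<open>n\<close>-sets differing in a single element have different sums, so one of
  them misses \<open>s\<close>.\<close>

lemma subset_sum_avoid:
  fixes Q :: "'a :: {ab_group_add, finite} set"
  assumes "0 < n" "n < card Q"
  shows "\<exists>A \<subseteq> Q. card A = n \<and> \<Sum>A \<noteq> s"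
proof -
  obtain A where A: "A \<subseteq> Q" "card A = n - 1"
    using assms by (metis diff_le_self le_trans less_imp_le obtain_subset_with_card_n)
  have "card (Q - A) \<ge> 2"
    using A assms by (subst card_Diff_subset) auto
  then obtain B where B: "B \<subseteq> Q - A" "card B = 2"
    by (rule obtain_subset_with_card_n)
  then obtain x y where "B = {x, y}" "x \<noteq> y" unfolding card_2_iff by blast
  then have xy: "x \<in> Q - A" "y \<in> Q - A" "x \<noteq> y" using B by auto
  then have "\<Sum>(insert x A) \<noteq> \<Sum>(insert y A)" by simp
  moreover have "card (insert z A) = n" if "z \<in> Q - A" for z
    using that A assms by simp
  ultimately show ?thesis using A xy
    by (metis DiffD1 insert_subset)
qed

section \<open>The doubled equation for subsets\<close>

text \<open>The left-hand side of the doubled equation. It depends on the set alone, so indices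
  return only at the very end.\<close>

definition qval :: "'a :: field \<Rightarrow> 'a set \<Rightarrow> 'a" where
  "qval a S = (\<Sum>x\<in>S. x\<^sup>2) + (\<Sum>S - a)\<^sup>2"

lemma qval_translate:
  fixes S :: "'a :: {field, finite} set"
  shows "qval a ((+) u ` S) = (\<Sum>x\<in>S. x\<^sup>2) + 2 * u * \<Sum>S + of_nat (card S) * u\<^sup>2
    + (\<Sum>S + of_nat (card S) * u - a)\<^sup>2"
proof -
  have "\<Sum>((+) u ` S) = \<Sum>S + of_nat (card S) * u"
    by (simp add: sum.reindex sum.distrib add.commute)
  moreover have "(\<Sum>x\<in>(+) u ` S. x\<^sup>2) = (\<Sum>x\<in>S. x\<^sup>2) + 2 * u * \<Sum>S + of_nat (card S) * u\<^sup>2"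
    by (simp add: sum.reindex sum.distrib power2_sum sum_distrib_left algebra_simps)
  ultimately show ?thesis by (simp add: qval_def)
qed

lemma card_translate: "card ((+) u ` S) = card S" for u :: "'a :: ab_group_add"
  by (rule card_image) simp

lemma ex_not_in:
  assumes "card N < CARD('a :: finite)"
  shows "\<exists>x :: 'a. x \<notin> N"
proof (rule ccontr)
  assume "\<not> ?thesis"
  then have "N = UNIV" by blast
  then show False using assms by simp
qed

text \<open>Multiplication by \<open>l\<close> permutes the field and scales the sum by
  \<open>l^2\<close>; more than three elements allow \<open>l^2\<close> to differ from both 0 and 1.
  As the sum of all elements vanishes too, both power sums change sign under complement.\<close>

lemma sum_squares_UNIV:
  assumes "CARD('a :: {field, finite}) > 3"
  shows "(\<Sum>x\<in>UNIV. x\<^sup>2) = (0 :: 'a)"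
proof -
  have "card {0, 1, -1 :: 'a} < CARD('a)"
    using assms by (rule le_less_trans[rotated]) (simp add: card_insert_if)
  then obtain l :: 'a where "l \<notin> {0, 1, -1}"
    using ex_not_in by blast
  then have l: "l \<noteq> 0" "l\<^sup>2 \<noteq> 1" by (auto simp: power2_eq_1_iff)
  have "(\<Sum>x\<in>UNIV. x\<^sup>2) = (\<Sum>x\<in>UNIV. (l * x)\<^sup>2)"
    by (rule sum.reindex_bij_witness[of _ "\<lambda>x. l * x" "\<lambda>x. x / l"]) (use l in auto)
  also have "\<dots> = l\<^sup>2 * (\<Sum>x\<in>UNIV. x\<^sup>2)"
    by (simp add: power_mult_distrib sum_distrib_left)
  finally show ?thesis using l by simp
qed

section \<open>Large subsets, through their complements\<close>

lemma qval_Compl: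
  fixes T :: "'a :: {field, finite} set"
  assumes "(2 :: 'a) \<noteq> 0" and "CARD('a) > 3"
  shows "qval a (- T) = - (\<Sum>x\<in>T. x\<^sup>2) + (\<Sum>T + a)\<^sup>2"
proof -
  have "\<Sum>(- T) + \<Sum>T = \<Sum>(UNIV :: 'a set)"
    by (subst sum.union_disjoint[symmetric]) (auto simp: Compl_partition2)
  then have "\<Sum>(- T) = - \<Sum>T"
    using sum_sqrt_set[of UNIV] assms by (simp add: eq_neg_iff_add_eq_0)
  moreover have "(\<Sum>x\<in>- T. x\<^sup>2) + (\<Sum>x\<in>T. x\<^sup>2) = (\<Sum>x\<in>UNIV. x\<^sup>2)"
    by (subst sum.union_disjoint[symmetric]) (auto simp: Compl_partition2)
  then have "(\<Sum>x\<in>- T. x\<^sup>2) = - (\<Sum>x\<in>T. x\<^sup>2)"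
    using sum_squares_UNIV assms by (simp add: eq_neg_iff_add_eq_0)
  ultimately show ?thesis
    by (simp add: qval_def power2_eq_square algebra_simps)
qed

text \<open>For \<open>d \<noteq> 0\<close> each \<open>b\<close> removes at most two points of the hyperbola \<open>XY = d\<close>.\<close>

lemma product_avoid:
  fixes d :: "'a :: {field, finite}"
  assumes few: "2 * card C + 3 < CARD('a)" and "0 \<notin> C"
  shows "\<exists>X Y. X * Y = d \<and> X \<noteq> Y \<and> X \<notin> C \<and> Y \<notin> C"
proof (cases "d = 0")
  case True
  have "card (insert 0 C) < CARD('a)"
    using few by (simp add: card_insert_if)
  then obtain Y where "Y \<notin> insert 0 C" using ex_not_in by blast
  then show ?thesis using True assms(2) by (intro exI[of _ 0] exI[of _ Y]) auto
next
  case False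
  \<comment> \<open>With \<open>Y = d / X\<close>, excluding \<open>C\<close> and its image under
    division keeps \<open>X\<close> and \<open>Y\<close> out of \<open>C\<close>; excluding the
    roots of \<open>d\<close> keeps them distinct.\<close>
  let ?N = "insert 0 (C \<union> (/) d ` C \<union> {x. 1 * x\<^sup>2 = d})"
  have "card ?N \<le> Suc (card (C \<union> (/) d ` C \<union> {x. 1 * x\<^sup>2 = d}))"
    by (simp add: card_insert_if)
  moreover have "card (C \<union> (/) d ` C \<union> {x. 1 * x\<^sup>2 = d}) \<le>
      card (C \<union> (/) d ` C) + card {x. 1 * x\<^sup>2 = d}" by (rule card_Un_le)
  moreover have "card (C \<union> (/) d ` C) \<le> card C + card ((/) d ` C)" by (rule card_Un_le)
  moreover have "card ((/) d ` C) \<le> card C" by (rule card_image_le) simp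
  moreover have "card {x :: 'a. 1 * x\<^sup>2 = d} \<le> 2" by (rule card_square_eq_le) simp
  ultimately have "card ?N < CARD('a)" using few by linarith
  then obtain X where X: "X \<notin> ?N" using ex_not_in by blast
  then have "X * (d / X) = d" "X \<noteq> d / X" "X \<notin> C"
    by (auto simp: power2_eq_square field_simps)
  moreover have "d / X \<notin> C"
  proof
    assume "d / X \<in> C"
    then have "d / (d / X) \<in> (/) d ` C" by blast
    then show False using X False by simp
  qed
  ultimately show ?thesis by blast
qed

text \<open>Shifting \<open>B\<close> by \<open>\<Sum>B + a\<close> then avoids 0, as
  \<open>product_avoid\<close> demands of its forbidden set. All elements but one are arbitrary, and
  the last is chosen to fit.\<close>

lemma subset_avoiding_sum:
  fixes a :: "'a :: {field, finite}"
  assumes two: "(2 :: 'a) \<noteq> 0" and n: "2 * n \<le> CARD('a)"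
  shows "\<exists>B. card B = n \<and> - (\<Sum>B + a) \<notin> B"
proof (cases n)
  case (Suc m)
  obtain B :: "'a set" where B: "card B = m"
    using obtain_subset_with_card_n[of m "UNIV :: 'a set"] n Suc by auto
  \<comment> \<open>The new element \<open>b\<close> must not lie in \<open>B\<close>, must not make
    the negated total equal to an old element, and must not make it equal to \<open>b\<close>
    itself.\<close>
  let ?N = "B \<union> (\<lambda>b. - \<Sum>B - a - b) ` B \<union> {- (\<Sum>B + a) / 2}"
  have "card ?N \<le> card (B \<union> (\<lambda>b. - \<Sum>B - a - b) ` B) + card {- (\<Sum>B + a) / 2}"
    by (rule card_Un_le)
  moreover have "card (B \<union> (\<lambda>b. - \<Sum>B - a - b) ` B) \<le>
      card B + card ((\<lambda>b. - \<Sum>B - a - b) ` B)" by (rule card_Un_le)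
  moreover have "card ((\<lambda>b. - \<Sum>B - a - b) ` B) \<le> card B" by (rule card_image_le) simp
  ultimately have "card ?N < CARD('a)" using B n Suc by simp
  then obtain b where b: "b \<notin> ?N" using ex_not_in by blast
  then have ins: "\<Sum>(insert b B) = b + \<Sum>B" "card (insert b B) = n"
    using B Suc by auto
  have "- (b + \<Sum>B + a) \<noteq> c" if "c \<in> B" for c
  proof
    assume c: "- (b + \<Sum>B + a) = c"
    have "b = - \<Sum>B - a - - (b + \<Sum>B + a)" by simp
    then have "b = - \<Sum>B - a - c" unfolding c .
    then show False using b that by blast
  qed
  moreover have "- (b + \<Sum>B + a) \<noteq> b"
  proof
    assume c: "- (b + \<Sum>B + a) = b"
    have "b + - (b + \<Sum>B + a) = - (\<Sum>B + a)" by simp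
    then have "b * 2 = - (\<Sum>B + a)" unfolding c by (simp only: mult_2_right)
    then have "b = - (\<Sum>B + a) / 2" using two by (simp add: nonzero_eq_divide_eq)
    then show False using b by blast
  qed
  ultimately show ?thesis using ins by (intro exI[of _ "insert b B"]) auto
qed (auto intro!: exI[of _ "{}"])

lemma qval_large:
  fixes a c :: "'a :: {field, finite}"
  assumes two: "(2 :: 'a) \<noteq> 0" and t: "CARD('a) \<le> 2 * t" "t + 2 \<le> CARD('a)" "CARD('a) > 3"
    and odd: "odd CARD('a)"
  shows "\<exists>S. card S = t \<and> qval a S = c"
proof -
  define n where "n = CARD('a) - t - 2"
  have n: "2 * n + 3 < CARD('a)" using t odd unfolding n_def by presburger
  then obtain B where B: "card B = n" "- (\<Sum>B + a) \<notin> B"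
    using subset_avoiding_sum[OF two, of n a] by auto
  define s where "s = \<Sum>B + a"
  have "card ((+) s ` B) = n" by (simp add: card_translate B)
  moreover have "0 \<notin> (+) s ` B"
  proof
    assume "0 \<in> (+) s ` B"
    then obtain b where "b \<in> B" "s + b = 0" by auto
    then show False using B(2) by (metis s_def add_eq_0_iff)
  qed
  \<comment> \<open>For the complement of \<open>B\<close> with \<open>x\<close>, \<open>y\<close>
    added, \<open>X = x + s\<close> and \<open>Y = y + s\<close> turn \<open>qval\<close> into
    \<open>2 * X * Y\<close> minus the sum of squares of \<open>B\<close> minus \<open>s^2\<close>;
    equating this to \<open>c\<close> gives the product.\<close>
  ultimately obtain X Y where XY: "X * Y = (c + (\<Sum>x\<in>B. x\<^sup>2) + s\<^sup>2) / 2"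
      "X \<noteq> Y" "X \<notin> (+) s ` B" "Y \<notin> (+) s ` B"
    using product_avoid[of "(+) s ` B" "(c + (\<Sum>x\<in>B. x\<^sup>2) + s\<^sup>2) / 2"] n by auto
  define x y where "x = X - s" and "y = Y - s"
  have xy: "x \<noteq> y" "x \<notin> B" "y \<notin> B"
    using XY by (auto simp: x_def y_def image_iff)
  have "card (- insert x (insert y B)) = t"
    using xy B t by (simp add: Compl_eq_Diff_UNIV card_Diff_subset n_def)
  moreover have "qval a (- insert x (insert y B)) =
      - (x\<^sup>2 + (y\<^sup>2 + (\<Sum>x\<in>B. x\<^sup>2))) + (x + (y + \<Sum>B) + a)\<^sup>2"
    using xy by (subst qval_Compl) (use two t in auto)
  moreover have "\<dots> = 2 * (X * Y) - (\<Sum>x\<in>B. x\<^sup>2) - s\<^sup>2"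
    by (simp add: x_def y_def s_def power2_eq_square algebra_simps)
  moreover have "2 * (X * Y) = c + (\<Sum>x\<in>B. x\<^sup>2) + s\<^sup>2"
    unfolding XY(1) using two by simp
  ultimately have "qval a (- insert x (insert y B)) = c" by simp
  then show ?thesis using \<open>card (- insert x (insert y B)) = t\<close> by blast
qed

section \<open>Values reached by translation\<close>

lemma qval_card_eq_0:
  fixes a c :: "'a :: {field, finite}"
  assumes two: "(2 :: 'a) \<noteq> 0" and t: "of_nat t = (0 :: 'a)" "0 < t" "t < CARD('a)"
  shows "\<exists>S. card S = t \<and> qval a S = c"
proof -
  obtain S :: "'a set" where S: "card S = t" "\<Sum>S \<noteq> 0"
    using subset_sum_avoid[of t UNIV 0] t by auto
  \<comment> \<open>As \<open>t\<close> is 0 in the field, translation by \<open>u\<close> changes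
    the value by \<open>2 * u * \<Sum>S\<close>, linear in \<open>u\<close>.\<close>
  define u where "u = (c - qval a S) / (2 * \<Sum>S)"
  have "u * (2 * \<Sum>S) = c - qval a S" using two S by (simp add: u_def)
  moreover have "qval a ((+) u ` S) = qval a S + u * (2 * \<Sum>S)"
    unfolding qval_translate S(1) t(1) by (simp add: qval_def algebra_simps)
  ultimately have "qval a ((+) u ` S) = c" by simp
  then show ?thesis using card_translate S(1) by blast
qed

lemma qval_card_eq_minus_1:
  fixes a c :: "'a :: {field, finite}"
  assumes two: "(2 :: 'a) \<noteq> 0" and t: "of_nat t + 1 = (0 :: 'a)" "t < CARD('a)"
    and a: "a \<noteq> 0"
  shows "\<exists>S. card S = t \<and> qval a S = c"
proof -
  obtain S :: "'a set" where S: "card S = t"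
    using obtain_subset_with_card_n[of t "UNIV :: 'a set"] t by auto
  have t': "of_nat t = - (1 :: 'a)" using t(1) by (simp add: eq_neg_iff_add_eq_0)
  \<comment> \<open>With \<open>t = -1\<close> the terms in \<open>u^2\<close> and in
    \<open>u * \<Sum>S\<close> cancel; translation by \<open>u\<close> adds
    \<open>2 * a * u\<close>, whatever \<open>S\<close> is.\<close>
  define u where "u = (c - qval a S) / (2 * a)"
  have u: "u * (2 * a) = c - qval a S" using two a by (simp add: u_def)
  have "qval a ((+) u ` S) = qval a S + u * (2 * a)"
    unfolding qval_translate S t' by (simp add: qval_def power2_eq_square algebra_simps)
  also have "\<dots> = c" by (simp add: u)
  finally show ?thesis using card_translate S(1) by blast
qed

section \<open>From subsets back to indexed families\<close>

lemma double_sum_pairs: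
  fixes X :: "nat \<Rightarrow> 'a :: comm_ring_1"
  shows "2 * (\<Sum>(i, j) \<in> {(i, j). 1 \<le> i \<and> i < j \<and> j \<le> t}. X i * X j) =
    (\<Sum>i = 1..t. X i)\<^sup>2 - (\<Sum>i = 1..t. (X i)\<^sup>2)"
proof (induction t)
  case 0
  have "{(i, j). 1 \<le> i \<and> i < j \<and> j \<le> (0 :: nat)} = {}" by auto
  then show ?case by (simp only:) simp
next
  case (Suc t)
  let ?P = "\<lambda>t. {(i, j). 1 \<le> i \<and> i < j \<and> j \<le> (t :: nat)}"
  have eq: "?P (Suc t) = ?P t \<union> (\<lambda>i. (i, Suc t)) ` {1..t}"
    by (auto simp: le_Suc_eq)
  have "?P t \<subseteq> {1..t} \<times> {1..t}" by auto
  then have fin: "finite (?P t)" by (rule finite_subset) simp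
  have "(\<Sum>(i, j) \<in> ?P (Suc t). X i * X j) =
      (\<Sum>(i, j) \<in> ?P t. X i * X j) + (\<Sum>(i, j) \<in> (\<lambda>i. (i, Suc t)) ` {1..t}. X i * X j)"
    unfolding eq using fin by (intro sum.union_disjoint) auto
  also have "(\<Sum>(i, j) \<in> (\<lambda>i. (i, Suc t)) ` {1..t}. X i * X j) = (\<Sum>i = 1..t. X i) * X (Suc t)"
    by (subst sum.reindex) (auto simp: inj_on_def sum_distrib_right)
  finally show ?case
    using Suc.IH by (simp add: power2_eq_square algebra_simps)
qed

lemma qval_imp_representation:
  fixes a b :: "'a :: {field, finite}"
  assumes two: "(2 :: 'a) \<noteq> 0" and S: "card S = t" "qval a S = 2 * b + a\<^sup>2"
  shows "\<exists>X :: nat \<Rightarrow> 'a. inj_on X {1..t} \<and>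
           b = (\<Sum>(i, j) \<in> {(i, j). 1 \<le> i \<and> i < j \<and> j \<le> t}. X i * X j)
             + (\<Sum>i = 1..t. (X i)\<^sup>2) - a * (\<Sum>i = 1..t. X i)" (is "\<exists>X. _ \<and> b = ?rhs X")
proof -
  obtain X where X: "bij_betw X {1..t} S"
    using ex_bij_betw_nat_finite_1[of S] S by auto
  have "(\<Sum>i = 1..t. X i) = \<Sum>S" "(\<Sum>i = 1..t. (X i)\<^sup>2) = (\<Sum>x\<in>S. x\<^sup>2)"
    by (intro sum.reindex_bij_betw[OF X])+
  then have "2 * ?rhs X = 2 * b"
    using S(2) unfolding right_diff_distrib distrib_left double_sum_pairs
    by (simp add: qval_def power2_eq_square algebra_simps)
  then have "b = ?rhs X" using two by (simp only: mult_left_cancel[OF two])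
  then show ?thesis using X unfolding bij_betw_def by blast
qed

section \<open>Symmetric sets\<close>

text \<open>The roots of \<open>A\<close> fill \<open>t\<close> places if \<open>t\<close> is even;
  if \<open>t\<close> is odd, the element 0 fills the last place without changing either
  sum.\<close>

lemma symmetric_set:
  fixes A :: "'a :: {field, finite} set"
  assumes two: "(2 :: 'a) \<noteq> 0" and A: "A \<subseteq> nonzero_squares" "card A = t div 2"
  shows "\<exists>S. card S = t \<and> \<Sum>S = 0 \<and> (\<Sum>x\<in>S. x\<^sup>2) = 2 * \<Sum>A"
proof -
  define P where "P = {x. x\<^sup>2 \<in> A}"
  have P: "card P = 2 * (t div 2)" "\<Sum>P = 0" "(\<Sum>x\<in>P. x\<^sup>2) = 2 * \<Sum>A"
    using sqrt_set[OF two A(1)] sum_sqrt_set[OF two, of A] A(2) by (auto simp: P_def)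
  show ?thesis
  proof (cases "even t")
    case True
    then show ?thesis using P by (intro exI[of _ P]) auto
  next
    case False
    have "0 \<notin> P" using A(1) by (auto simp: P_def nonzero_squares_def)
    then show ?thesis using P False by (intro exI[of _ "insert 0 P"]) auto
  qed
qed

text \<open>Completing the square in the centre: it is written \<open>v + w\<close> with
  \<open>w = a / (t + 1)\<close>, which removes the term linear in \<open>v\<close>.\<close>

lemma qval_centered:
  fixes S :: "'a :: {field, finite} set"
  assumes S: "card S = t" "\<Sum>S = 0" and a: "a = w * (of_nat t + 1)"
    and c: "(\<Sum>x\<in>S. x\<^sup>2) + of_nat t * (of_nat t + 1) * v\<^sup>2 = c - (of_nat t + 1) * w\<^sup>2"
  shows "\<exists>S. card S = t \<and> qval a S = c"
proof -
  have "qval a ((+) (v + w) ` S) =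
      (\<Sum>x\<in>S. x\<^sup>2) + of_nat t * (of_nat t + 1) * v\<^sup>2 + (of_nat t + 1) * w\<^sup>2"
    unfolding qval_translate S a by (simp add: power2_eq_square algebra_simps)
  also have "\<dots> = c" unfolding c by simp
  finally show ?thesis using card_translate S(1) by blast
qed

lemma card_insert_0_sqrt_set:
  fixes A :: "'a :: {field, finite} set"
  assumes "(2 :: 'a) \<noteq> 0" and "A \<subseteq> nonzero_squares"
  shows "card (insert 0 {x. x\<^sup>2 \<in> A}) \<le> 2 * card A + 1"
  using sqrt_set[OF assms] by (simp add: card_insert_if)

text \<open>All pairs but one are fixed by \<open>A\<close>; the last root \<open>r\<close> and the
  offset \<open>v\<close> of the centre run over a conic. Its constant must be nonzero: for
  \<open>t\<close> at least 4 a suitable \<open>A\<close> achieves this, while for smaller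
  \<open>t\<close> the set \<open>A\<close> is empty and \<open>exc\<close> is needed.\<close>

lemma qval_generic:
  fixes a c w :: "'a :: {field, finite}"
  assumes two: "(2 :: 'a) \<noteq> 0" and t: "2 \<le> t" "2 * t < CARD('a)"
    and nz: "of_nat t \<noteq> (0 :: 'a)" "of_nat t + 1 \<noteq> (0 :: 'a)"
    and a: "a = w * (of_nat t + 1)"
    and exc: "4 \<le> t \<or> c \<noteq> (of_nat t + 1) * w\<^sup>2"
  shows "\<exists>S. card S = t \<and> qval a S = c"
proof -
  define c' where "c' = c - (of_nat t + 1) * w\<^sup>2"
  define k where "k = t div 2"
  have "\<exists>A \<subseteq> nonzero_squares. card A = k - 1 \<and> 2 * \<Sum>A \<noteq> c'"
  proof (cases "4 \<le> t")
    case True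
    then have "0 < k - 1" "k - 1 < card (nonzero_squares :: 'a set)"
      using card_nonzero_squares[OF two] t unfolding k_def by linarith+
    from subset_sum_avoid[OF this, of "c' / 2"] show ?thesis
      using two by (auto simp: eq_divide_eq mult.commute)
  next
    case False
    then have "k - 1 = 0" by (simp add: k_def)
    then show ?thesis using exc False by (intro exI[of _ "{}"]) (auto simp: c'_def)
  qed
  then obtain A :: "'a set" where A: "A \<subseteq> nonzero_squares" "card A = k - 1" "2 * \<Sum>A \<noteq> c'"
    by blast
  \<comment> \<open>Excluding 0 and the roots of \<open>A\<close> makes \<open>r^2\<close> a new
    nonzero square.\<close>
  have "2 * card (insert 0 {x. x\<^sup>2 \<in> A}) + 2 * card ({} :: 'a set) + 1 < CARD('a)"
    using card_insert_0_sqrt_set[OF two A(1)] A(2) t unfolding k_def card.empty by linarith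
  moreover have "of_nat t * (of_nat t + 1) \<noteq> (0 :: 'a)" "c' - 2 * \<Sum>A \<noteq> 0"
    using nz A(3) by auto
  ultimately obtain r v where rv: "2 * r\<^sup>2 + of_nat t * (of_nat t + 1) * v\<^sup>2 = c' - 2 * \<Sum>A"
      "r \<notin> insert 0 {x. x\<^sup>2 \<in> A}"
    using conic_avoid[OF two two] by blast
  have sq: "insert (r\<^sup>2) A \<subseteq> nonzero_squares" "card (insert (r\<^sup>2) A) = t div 2"
    using rv(2) A(1,2) t by (auto simp: nonzero_squares_def k_def)
  obtain S where S: "card S = t" "\<Sum>S = 0" "(\<Sum>x\<in>S. x\<^sup>2) = 2 * \<Sum>(insert (r\<^sup>2) A)"
    using symmetric_set[OF two sq] by blast
  have "(\<Sum>x\<in>S. x\<^sup>2) = 2 * r\<^sup>2 + 2 * \<Sum>A"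
    using S(3) rv(2) by (simp add: distrib_left)
  then have "(\<Sum>x\<in>S. x\<^sup>2) + of_nat t * (of_nat t + 1) * v\<^sup>2 =
      (2 * r\<^sup>2 + of_nat t * (of_nat t + 1) * v\<^sup>2) + 2 * \<Sum>A"
    by (simp only: add_ac)
  also have "\<dots> = c - (of_nat t + 1) * w\<^sup>2"
    unfolding rv(1) by (simp add: c'_def)
  finally show ?thesis by (rule qval_centered[OF S(1,2) a])
qed

lemma of_nat_CARD_eq_0: "of_nat CARD('a :: {field, finite}) = (0 :: 'a)"
  using CHAR_dvd_CARD by (simp only: of_nat_eq_0_iff_char_dvd)

text \<open>The symmetric set \<open>{0, r, -r}\<close> would give a homogeneous equation, possibly
  with only the zero solution. A three-element set of sum 0 that need not be symmetric gives a conic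
  with nonzero constant instead.\<close>

lemma qval_three:
  fixes a w :: "'a :: {field, finite}"
  assumes two: "(2 :: 'a) \<noteq> 0" and three: "(3 :: 'a) \<noteq> 0"
    and q: "7 \<le> CARD('a)" and a: "a = w * (of_nat 3 + 1)"
  shows "\<exists>S. card S = 3 \<and> qval a S = (of_nat 3 + 1) * w\<^sup>2"
proof (cases "CARD('a) = 7")
  case True
  then have seven: "(7 :: 'a) = 0" using of_nat_CARD_eq_0[where 'a = 'a] by simp
  have ne: "(1 :: 'a) \<noteq> -1" using two by (simp add: eq_neg_iff_add_eq_0)
  show ?thesis
  proof (rule qval_centered)
    show "card {0, 1, -1 :: 'a} = 3" "\<Sum>{0, 1, -1 :: 'a} = 0" using ne by simp_all
    \<comment> \<open>For q = 7 the point count below is too small by one; here the offset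
      \<open>v = 1\<close> gives 2 + 12 = 14 = 0.\<close>
    have "(14 :: 'a) = 2 * 7" by simp
    then show "(\<Sum>x\<in>{0, 1, -1 :: 'a}. x\<^sup>2) + of_nat 3 * (of_nat 3 + 1) * 1\<^sup>2 =
        (of_nat 3 + 1) * w\<^sup>2 - (of_nat 3 + 1) * w\<^sup>2"
      using ne seven by simp
  qed (rule a)
next
  case False
  have six: "(6 :: 'a) \<noteq> 0"
  proof -
    have "(6 :: 'a) = 2 * 3" by simp
    then show ?thesis using two three by (metis no_zero_divisors)
  qed
  have "(-18 :: 'a) = - (6 * 3)" by simp
  then have d: "(-18 :: 'a) \<noteq> 0" using six three by (metis neg_equal_0_iff_equal no_zero_divisors)
  have "2 * card {0, 3, -3 :: 'a} + 2 * card ({} :: 'a set) + 1 < CARD('a)"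
    using q False by (simp add: card_insert_if)
  then obtain u s :: 'a where us: "6 * u\<^sup>2 + 1 * s\<^sup>2 = -18" "u \<notin> {0, 3, -3}"
    using conic_avoid[OF two six one_neq_zero d] by blast
  \<comment> \<open>The sum is 0 and the sum of squares is \<open>2 * u^2 + 6\<close>. With offset
    \<open>s / 6\<close>, three times the required equation is the conic above; the excluded values
    of \<open>u\<close> are exactly those making two elements equal.\<close>
  define S where "S = {2, u - 1, - u - 1}"
  have ne: "2 \<noteq> u - 1" "2 \<noteq> - u - 1" "u - 1 \<noteq> - u - 1"
  proof -
    show "2 \<noteq> u - 1" using us(2) by (auto simp: eq_diff_eq)
    show "2 \<noteq> - u - 1"
    proof
      assume "2 = - u - 1"
      then have "- u = 3" by (simp add: eq_diff_eq)
      then have "u = -3" by (metis add.inverse_inverse)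
      then show False using us(2) by simp
    qed
    show "u - 1 \<noteq> - u - 1"
    proof
      assume "u - 1 = - u - 1"
      then have "u + u = 0" by (simp add: eq_neg_iff_add_eq_0)
      then have "2 * u = 0" by (simp only: mult_2)
      then show False using us(2) two by simp
    qed
  qed
  show ?thesis
  proof (rule qval_centered)
    show "card S = 3" "\<Sum>S = 0" using ne by (simp_all add: S_def)
    have "(\<Sum>x\<in>S. x\<^sup>2) + 12 * (s / 6)\<^sup>2 = 2 * u\<^sup>2 + 6 + 12 * (s / 6)\<^sup>2"
      using ne by (simp add: S_def power2_eq_square algebra_simps)
    also have "\<dots> = (6 * u\<^sup>2 + 1 * s\<^sup>2 + 18) / 3"
    proof -
      have "3 * (12 * (s / 6)\<^sup>2) = (6 * (s / 6))\<^sup>2"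
        by (simp only: power_mult_distrib) simp
      also have "\<dots> = s\<^sup>2" using six by simp
      finally have "3 * (12 * (s / 6)\<^sup>2) = s\<^sup>2" .
      then have "3 * (2 * u\<^sup>2 + 6 + 12 * (s / 6)\<^sup>2) = 6 * u\<^sup>2 + 1 * s\<^sup>2 + 18"
        by (simp only: distrib_left) simp
      then show ?thesis using three by (simp add: eq_divide_eq mult.commute)
    qed
    finally show "(\<Sum>x\<in>S. x\<^sup>2) + of_nat 3 * (of_nat 3 + 1) * (s / 6)\<^sup>2 =
        (of_nat 3 + 1) * w\<^sup>2 - (of_nat 3 + 1) * w\<^sup>2"
      unfolding us(1) by simp
  qed (rule a)
qed

text \<open>For \<open>a = 0\<close> the value is homogeneous of degree 2, so dividing a set by
  \<open>v\<close> divides it by \<open>v^2\<close>. It suffices that a symmetric set has value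
  \<open>c * v^2\<close> with \<open>v\<close> nonzero, which is again a conic condition on
  \<open>r\<close> and \<open>v\<close>.\<close>

lemma qval_0_nonzero:
  fixes c :: "'a :: {field, finite}"
  assumes two: "(2 :: 'a) \<noteq> 0" and t: "4 \<le> t" "2 * t + 1 < CARD('a)" and c: "c \<noteq> 0"
  shows "\<exists>S. card S = t \<and> qval 0 S = c"
proof -
  define k where "k = t div 2"
  have "0 < k - 1" "k - 1 < card (nonzero_squares :: 'a set)"
    using card_nonzero_squares[OF two] t unfolding k_def by linarith+
  then obtain A :: "'a set" where A: "A \<subseteq> nonzero_squares" "card A = k - 1" "\<Sum>A \<noteq> 0"
    using subset_sum_avoid by blast
  \<comment> \<open>Excluding \<open>v = 0\<close> costs two further points, hence the bound on
    \<open>2 * t + 1\<close>.\<close>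
  have "2 * card (insert 0 {x. x\<^sup>2 \<in> A}) + 2 * card {0 :: 'a} + 1 < CARD('a)"
    using card_insert_0_sqrt_set[OF two A(1)] A(2) t card_nonzero_squares[OF two]
    unfolding k_def by simp
  moreover have "- (c / 2) \<noteq> 0" "- \<Sum>A \<noteq> 0" using c two A(3) by auto
  ultimately obtain r v where rv: "1 * r\<^sup>2 + - (c / 2) * v\<^sup>2 = - \<Sum>A"
      "r \<notin> insert 0 {x. x\<^sup>2 \<in> A}" "v \<notin> {0}"
    using conic_avoid[OF two one_neq_zero] by blast
  define B where "B = (\<lambda>x. x / v\<^sup>2) ` insert (r\<^sup>2) A"
  have "insert (r\<^sup>2) A \<subseteq> nonzero_squares"
    using rv(2) A(1) by (auto simp: nonzero_squares_def)
  then have B1: "B \<subseteq> nonzero_squares"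
    using rv(3) unfolding B_def nonzero_squares_def
    by (fastforce simp: power_divide[symmetric])
  have inj: "inj_on (\<lambda>x. x / v\<^sup>2) (insert (r\<^sup>2) A)" using rv(3) by (simp add: inj_on_def)
  then have "card B = card (insert (r\<^sup>2) A)" unfolding B_def by (rule card_image)
  then have B2: "card B = t div 2" using rv(2) A(2) t by (simp add: k_def)
  have "\<Sum>B = (r\<^sup>2 + \<Sum>A) / v\<^sup>2"
    using rv(2) unfolding B_def sum.reindex[OF inj] by (simp add: sum_divide_distrib add_divide_distrib)
  also have "r\<^sup>2 + \<Sum>A = c / 2 * v\<^sup>2" using rv(1) by (simp add: algebra_simps)
  finally have "2 * \<Sum>B = c" using rv(3) two by (simp add: mult.commute[of 2])
  then show ?thesis
    using symmetric_set[OF two B1 B2] by (auto simp: qval_def)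
qed

section \<open>Unions of cosets of the prime field\<close>

definition prime_coset :: "'a :: {field, finite} \<Rightarrow> 'a set" where
  "prime_coset x = (\<lambda>n. x + of_nat n) ` {..<CHAR('a)}"

text \<open>Since 1 generates the prime field additively, these are the unions of cosets of the
  prime field; the one-step form lets power sums be compared under \<open>x + 1\<close>.\<close>

definition shift_closed :: "'a :: {field, finite} set \<Rightarrow> bool" where
  "shift_closed S \<longleftrightarrow> (\<forall>x\<in>S. x + 1 \<in> S)"

lemma CHAR_finite_pos: "CHAR('a :: {field, finite}) > 0"
  by (rule finite_imp_CHAR_pos) simp

lemma shift_closed_add: "shift_closed S \<Longrightarrow> x \<in> S \<Longrightarrow> x + of_nat n \<in> S"
proof (induction n)
  case (Suc n)
  then have "x + of_nat n + 1 \<in> S" by (simp add: shift_closed_def)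
  then show ?case by (simp add: add_ac)
qed simp

lemma inj_on_prime_coset: "inj_on (\<lambda>n. x + of_nat n :: 'a :: {field, finite}) {..<CHAR('a)}"
  by (auto simp: inj_on_def of_nat_eq_iff_cong_CHAR cong_def)

lemma card_prime_coset: "card (prime_coset (x :: 'a :: {field, finite})) = CHAR('a)"
  unfolding prime_coset_def by (simp add: card_image[OF inj_on_prime_coset])

lemma self_in_prime_coset: "x \<in> prime_coset x"
proof -
  have "x = x + of_nat 0" by simp
  then show ?thesis unfolding prime_coset_def using CHAR_finite_pos by blast
qed

lemma shift_closed_prime_coset: "shift_closed (prime_coset (x :: 'a :: {field, finite}))"
  unfolding shift_closed_def
proof
  fix y assume "y \<in> prime_coset x"
  then obtain n where y: "y = x + of_nat n" by (auto simp: prime_coset_def)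
  have "(of_nat (Suc n mod CHAR('a)) :: 'a) = of_nat (Suc n)"
    by (simp only: of_nat_eq_iff_cong_CHAR cong_mod_left cong_refl)
  then have "y + 1 = x + of_nat (Suc n mod CHAR('a))" by (simp add: y add_ac)
  then show "y + 1 \<in> prime_coset x"
    unfolding prime_coset_def using CHAR_finite_pos[where 'a = 'a]
    by (metis imageI lessThan_iff mod_less_divisor)
qed

lemma prime_coset_disjoint:
  fixes S :: "'a :: {field, finite} set"
  assumes S: "shift_closed S" and x: "x \<notin> S"
  shows "prime_coset x \<inter> S = {}"
proof (rule ccontr)
  assume "\<not> ?thesis"
  then obtain n where "x + of_nat n \<in> S" by (auto simp: prime_coset_def)
  \<comment> \<open>Closure only allows steps forward, so \<open>x\<close> is reached from
    \<open>x + n\<close> by going on to a multiple of the characteristic.\<close>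
  from shift_closed_add[OF S this, of "n * (CHAR('a) - 1)"]
  have "x + of_nat (n + n * (CHAR('a) - 1)) \<in> S" by (simp only: of_nat_add add.assoc)
  moreover have "n + n * (CHAR('a) - 1) = n * CHAR('a)"
    using CHAR_finite_pos[where 'a = 'a] by (cases "CHAR('a)") auto
  ultimately have "x + of_nat (n * CHAR('a)) \<in> S" by (simp only:)
  then show False using x by simp
qed

lemma sum_shift_closed:
  fixes S :: "'a :: {field, finite} set" and g :: "'a \<Rightarrow> 'a"
  assumes "shift_closed S"
  shows "(\<Sum>x\<in>S. g (x + 1)) = (\<Sum>x\<in>S. g x)"
proof -
  have inj: "inj_on (\<lambda>x. x + 1) S" by simp
  have "(\<lambda>x. x + 1) ` S \<subseteq> S" using assms by (auto simp: shift_closed_def)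
  then have "(\<lambda>x. x + 1) ` S = S" by (rule endo_inj_surj[rotated]) (simp_all add: inj)
  then show ?thesis using sum.reindex[OF inj, of g] by (simp add: o_def)
qed

text \<open>Summing \<open>(x + 1)^k - x^k\<close> over \<open>S\<close> gives 0. Taking
  \<open>k\<close> = 1, 2, 3 in turn kills the cardinality, the sum, and the sum of squares; the
  last step divides by 3, so characteristic 3 needs another argument.\<close>

lemma shift_closed_card_eq_0:
  "shift_closed S \<Longrightarrow> of_nat (card S) = (0 :: 'a)" for S :: "'a :: {field, finite} set"
  using sum_shift_closed[of S "\<lambda>x. x"] by (simp add: sum.distrib)

lemma shift_closed_sum_eq_0:
  fixes S :: "'a :: {field, finite} set"
  assumes two: "(2 :: 'a) \<noteq> 0" and S: "shift_closed S"
  shows "\<Sum>S = 0"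
proof -
  have "(\<Sum>x\<in>S. (x + 1)\<^sup>2) = (\<Sum>x\<in>S. x\<^sup>2) + 2 * \<Sum>S + of_nat (card S)"
    by (simp add: power2_sum sum.distrib sum_distrib_left algebra_simps)
  then show ?thesis
    using two sum_shift_closed[OF S, of "\<lambda>x. x\<^sup>2"] shift_closed_card_eq_0[OF S] by simp
qed

lemma shift_closed_sum_squares_eq_0:
  fixes S :: "'a :: {field, finite} set"
  assumes "(2 :: 'a) \<noteq> 0" and three: "(3 :: 'a) \<noteq> 0" and S: "shift_closed S"
  shows "(\<Sum>x\<in>S. x\<^sup>2) = 0"
proof -
  have "(x + 1) ^ 3 = x ^ 3 + 3 * x\<^sup>2 + 3 * x + 1" for x :: 'a
    by (simp add: power2_eq_square power3_eq_cube algebra_simps)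
  then have "(\<Sum>x\<in>S. (x + 1) ^ 3) =
      (\<Sum>x\<in>S. x ^ 3) + 3 * (\<Sum>x\<in>S. x\<^sup>2) + 3 * \<Sum>S + of_nat (card S)"
    by (simp add: sum.distrib sum_distrib_left)
  then show ?thesis
    using three sum_shift_closed[OF S, of "\<lambda>x. x ^ 3"] shift_closed_card_eq_0[OF S]
      shift_closed_sum_eq_0[OF assms(1) S] by simp
qed

lemma sum_prime_coset:
  "(\<Sum>y\<in>prime_coset x. g y) = (\<Sum>n<CHAR('a). g (x + of_nat n))"
  for x :: "'a :: {field, finite}"
  unfolding prime_coset_def by (simp add: sum.reindex[OF inj_on_prime_coset])

text \<open>The terms involving \<open>x\<close> carry the factor \<open>CHAR('a)\<close> or the sum
  of the prime field, both 0. Every coset thus contributes the same constant, also in characteristic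
  3.\<close>

lemma sum_squares_prime_coset:
  fixes x :: "'a :: {field, finite}"
  assumes "(2 :: 'a) \<noteq> 0"
  shows "(\<Sum>y\<in>prime_coset x. y\<^sup>2) = (\<Sum>n<CHAR('a). (of_nat n)\<^sup>2)"
proof -
  have "(\<Sum>n<CHAR('a). of_nat n) = (0 :: 'a)"
    using shift_closed_sum_eq_0[OF assms shift_closed_prime_coset[of 0]]
    by (simp add: sum_prime_coset)
  moreover have "(\<Sum>y\<in>prime_coset x. y\<^sup>2) = of_nat CHAR('a) * x\<^sup>2
      + 2 * x * (\<Sum>n<CHAR('a). of_nat n) + (\<Sum>n<CHAR('a). (of_nat n)\<^sup>2)"
    unfolding sum_prime_coset power2_sum sum.distrib sum_distrib_left by (simp del: of_nat_CHAR)
  ultimately show ?thesis by simp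
qed

text \<open>Cosets are added one at a time, each through a point outside \<open>U\<close> and
  \<open>W\<close>; the set \<open>W\<close> is kept clear for a subset chosen beforehand.\<close>

lemma shift_closed_extension:
  fixes W :: "'a :: {field, finite} set"
  assumes two: "(2 :: 'a) \<noteq> 0" and W: "shift_closed W" and i: "card W + CHAR('a) * i \<le> CARD('a)"
  shows "\<exists>U. U \<inter> W = {} \<and> shift_closed U \<and> card U = CHAR('a) * i \<and>
    (\<Sum>x\<in>U. x\<^sup>2) = of_nat i * (\<Sum>n<CHAR('a). (of_nat n)\<^sup>2)"
  using i
proof (induction i)
  case 0
  show ?case by (intro exI[of _ "{}"]) (simp add: shift_closed_def)
next
  case (Suc i)
  then obtain U where U: "U \<inter> W = {}" "shift_closed U" "card U = CHAR('a) * i"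
      "(\<Sum>x\<in>U. x\<^sup>2) = of_nat i * (\<Sum>n<CHAR('a). (of_nat n)\<^sup>2)" by auto
  have "card (U \<union> W) < CARD('a)"
    using card_Un_le[of U W] U(3) Suc.prems CHAR_finite_pos[where 'a = 'a] by simp
  then obtain x where x: "x \<notin> U \<union> W" using ex_not_in by blast
  have "shift_closed (U \<union> W)" using U(2) W by (auto simp: shift_closed_def)
  from prime_coset_disjoint[OF this x]
  have disj: "U \<inter> prime_coset x = {}" "prime_coset x \<inter> W = {}" by auto
  show ?case
  proof (intro exI[of _ "U \<union> prime_coset x"] conjI)
    show "(U \<union> prime_coset x) \<inter> W = {}" using U(1) disj by blast
    show "shift_closed (U \<union> prime_coset x)"
      using U(2) shift_closed_prime_coset[of x] by (auto simp: shift_closed_def)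
    show "card (U \<union> prime_coset x) = CHAR('a) * Suc i"
      using disj(1) U(3) by (simp add: card_Un_disjoint card_prime_coset)
    show "(\<Sum>x\<in>U \<union> prime_coset x. x\<^sup>2) = of_nat (Suc i) * (\<Sum>n<CHAR('a). (of_nat n)\<^sup>2)"
      using disj(1) U(4) by (simp add: sum.union_disjoint sum_squares_prime_coset[OF two] distrib_right)
  qed
qed

lemma qval_0_zero:
  assumes two: "(2 :: 'a :: {field, finite}) \<noteq> 0" and three: "(3 :: 'a) \<noteq> 0"
    and t: "of_nat t + 1 = (0 :: 'a)" "t < CARD('a)"
  shows "\<exists>S :: 'a set. card S = t \<and> qval 0 S = 0"
proof -
  have "of_nat (t + 1) = (0 :: 'a)" using t(1) by (simp only: of_nat_add of_nat_1)
  then obtain i where i: "t + 1 = CHAR('a) * i"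
    by (auto simp only: of_nat_eq_0_iff_char_dvd elim: dvdE)
  have "shift_closed ({} :: 'a set)" by (simp add: shift_closed_def)
  from shift_closed_extension[OF two this, of i]
  obtain U :: "'a set" where U: "shift_closed U" "card U = t + 1" using i t(2) by auto
  then obtain y where y: "y \<in> U" by fastforce
  have "card (U - {y}) = t" using U y by simp
  \<comment> \<open>Both power sums of \<open>U\<close> vanish, so removing \<open>y\<close> leaves
    \<open>- y^2 + (- y)^2 = 0\<close>.\<close>
  moreover have "\<Sum>(U - {y}) = - y" "(\<Sum>x\<in>U - {y}. x\<^sup>2) = - (y\<^sup>2)"
    using shift_closed_sum_eq_0[OF two U(1)] shift_closed_sum_squares_eq_0[OF two three U(1)] y
    by (simp_all add: sum_diff1)
  then have "qval 0 (U - {y}) = 0" by (simp add: qval_def)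
  ultimately show ?thesis by blast
qed

section \<open>Characteristic 3\<close>

lemma qval_0_five:
  fixes c :: "'a :: {field, finite}"
  assumes three: "(3 :: 'a) = 0" and q: "13 < CARD('a)"
  shows "\<exists>S. card S = 5 \<and> qval 0 S = c"
proof -
  define d where "d = c + 1"
  let ?K = "{y :: 'a. 1 * y\<^sup>2 = d}" and ?L = "{y :: 'a. 1 * y\<^sup>2 = d + 1}"
  \<comment> \<open>These at most 13 values of \<open>x\<close> are the ones for which two of the
    five elements chosen below could coincide. In characteristic 3, \<open>m + x + 1\<close> is
    \<open>(x - 1)^2 - d\<close>, and similarly for the other differences, which explains the
    shifted root sets.\<close>
  let ?N = "{0, 1, -1} \<union> (?K \<union> ((+) 1 ` ?K \<union> ((+) (-1) ` ?K \<union> ((+) 1 ` ?L \<union> (+) (-1) ` ?L))))"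
  have "card ?K \<le> 2" "card ?L \<le> 2" by (intro card_square_eq_le one_neq_zero)+
  moreover have "card {0, 1, -1 :: 'a} \<le> 3" by (simp add: card_insert_if)
  ultimately have "card ?N \<le> 3 + (2 + (2 + (2 + (2 + 2))))"
    by (intro order.trans[OF card_Un_le] add_mono) (simp_all only: card_translate)
  then have "card ?N < CARD('a)" using q by simp
  then obtain x where x: "x \<notin> ?N" using ex_not_in by blast
  have x1: "x \<noteq> 0" "x \<noteq> 1" "x \<noteq> -1" "x\<^sup>2 \<noteq> d" using x by auto
  have shift: "(x - u)\<^sup>2 \<noteq> e" if "x \<notin> (+) u ` {y. 1 * y\<^sup>2 = e}" for u e
  proof
    assume "(x - u)\<^sup>2 = e"
    then have "x = u + (x - u)" "x - u \<in> {y. 1 * y\<^sup>2 = e}" by simp_all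
    then show False using that by blast
  qed
  have x2: "(x - 1)\<^sup>2 \<noteq> d" "(x - -1)\<^sup>2 \<noteq> d" "(x - 1)\<^sup>2 \<noteq> d + 1" "(x - -1)\<^sup>2 \<noteq> d + 1"
    using x by (intro shift; blast)+
  have triple: "y = z" if "y = z + 3 * e" for y z e :: 'a using that three by simp
  have id1: "(x - 1)\<^sup>2 = x\<^sup>2 + x + 1" "(x - -1)\<^sup>2 = x\<^sup>2 - x + 1"
    by (rule triple[of _ _ "-x"], simp add: power2_eq_square algebra_simps)
       (rule triple[of _ _ x], simp add: power2_eq_square algebra_simps)
  define m where "m = x\<^sup>2 - d"
  have m: "m \<noteq> 0" "m + x + 1 \<noteq> 0" "m - x + 1 \<noteq> 0" "m + x \<noteq> 0" "m - x \<noteq> 0"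
    using x1(4) x2 unfolding id1 m_def by (auto simp: algebra_simps)
  have xx: "x \<noteq> -x"
  proof
    assume "x = -x"
    have "x = - x + 3 * x - x" by simp
    then show False using x1(1) \<open>x = -x\<close> three by simp
  qed
  \<comment> \<open>The value of this set is \<open>2 + 4 * (x^2 - m) + 6 * m^2\<close>. As
    \<open>x^2 - m = d = c + 1\<close>, it is \<open>c\<close> modulo 3 for every \<open>x\<close>,
    so \<open>x\<close> is free to secure distinctness.\<close>
  define S where "S = {1, x, -x, -m - x, -m + x}"
  have ne: "x \<noteq> 1" "-x \<noteq> 1" "-m - x \<noteq> 1" "-m + x \<noteq> 1" "-m - x \<noteq> x" "-m - x \<noteq> -x"
      "-m + x \<noteq> x" "-m + x \<noteq> -x" "-m - x \<noteq> -m + x"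
  proof -
    show "-m - x \<noteq> x"
    proof
      assume h: "-m - x = x"
      have "m - x = x - (-m - x) - 3 * x" by simp
      from this[unfolded h three] show False using m(5) by simp
    qed
    show "-m + x \<noteq> -x"
    proof
      assume h: "-m + x = -x"
      have "m + x = - x - (-m + x) + 3 * x" by simp
      from this[unfolded h three] show False using m(4) by simp
    qed
    show "-m - x \<noteq> 1"
    proof
      assume h: "-m - x = 1"
      have "m + x + 1 = 1 - (-m - x)" by simp
      then show False unfolding h using m by simp
    qed
    show "-m + x \<noteq> 1"
    proof
      assume h: "-m + x = 1"
      have "m - x + 1 = 1 - (-m + x)" by simp
      then show False unfolding h using m by simp
    qed
  qed (use x1 m xx in \<open>auto simp: minus_equation_iff\<close>)
  have "card S = 5" unfolding S_def using ne ne[symmetric] xx xx[symmetric] by simp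
  moreover have "qval 0 S = c"
  proof -
    have sums: "\<Sum>S = 1 - 2 * m" "(\<Sum>y\<in>S. y\<^sup>2) = 1 + 4 * x\<^sup>2 + 2 * m\<^sup>2"
      unfolding S_def using ne ne[symmetric] xx xx[symmetric]
      by (simp_all, simp_all add: power2_eq_square algebra_simps)
    have "qval 0 S = c + 3 * (2 + c + 2 * m\<^sup>2)"
      unfolding qval_def sums
      by (simp add: m_def d_def power2_eq_square algebra_simps)
    then show ?thesis using three by simp
  qed
  ultimately show ?thesis by blast
qed

text \<open>Here \<open>t = 5 + 3 * i\<close>: a five-element set is joined with \<open>i\<close>
  whole cosets, each adding 2 to the sum of squares and 0 to the sum, so the five elements must
  supply \<open>c - 2 * i\<close>.\<close>

lemma qval_0_char_3:
  fixes c :: "'a :: {field, finite}"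
  assumes two: "(2 :: 'a) \<noteq> 0" and three: "(3 :: 'a) = 0"
    and t: "of_nat t + 1 = (0 :: 'a)" "3 \<le> t" "2 * t < CARD('a)"
  shows "\<exists>S. card S = t \<and> qval 0 S = c"
proof -
  have "of_nat 3 = (0 :: 'a)" using three by simp
  then have "CHAR('a) dvd 3" by (simp only: of_nat_eq_0_iff_char_dvd)
  moreover from this have "CHAR('a) \<le> 3" by (rule dvd_imp_le) simp
  then have "CHAR('a) \<in> {0, 1, 2, 3}" unfolding insert_iff empty_iff by arith
  ultimately have char: "CHAR('a) = 3"
    using CHAR_finite_pos[where 'a = 'a] CHAR_not_1'[where 'a = 'a] by auto
  have "of_nat (t + 1) = (0 :: 'a)" using t(1) by (simp only: of_nat_add of_nat_1)
  then have "3 dvd t + 1" by (simp only: of_nat_eq_0_iff_char_dvd char)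
  then have "t = 5 + 3 * ((t - 5) div 3)" using t(2) by presburger
  then obtain i where i: "t = 5 + 3 * i" by blast
  have q: "3 dvd CARD('a)" "odd CARD('a)"
    using CHAR_dvd_CARD[where 'a = 'a] char card_nonzero_squares[OF two] by auto
  \<comment> \<open>An odd multiple of 3 above \<open>2 * t = 10 + 6 * i\<close> is at least
    \<open>15 + 6 * i\<close>; this also leaves room for \<open>W\<close> and the \<open>i\<close>
    cosets below.\<close>
  have "13 < CARD('a)" using i t(3) q by presburger
  from qval_0_five[OF three this, of "c - 2 * of_nat i"]
  obtain S :: "'a set" where S: "card S = 5" "qval 0 S = c - 2 * of_nat i" by blast
  define W where "W = (\<Union>x\<in>S. prime_coset x)"
  have W: "shift_closed W"
    using shift_closed_prime_coset unfolding W_def shift_closed_def by blast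
  have SW: "S \<subseteq> W" using self_in_prime_coset by (auto simp: W_def)
  have "card W \<le> (\<Sum>x\<in>S. card (prime_coset x))" unfolding W_def by (intro card_UN_le) simp
  then have "card W \<le> 15" using S(1) by (simp add: card_prime_coset char)
  then have "card W + CHAR('a) * i \<le> CARD('a)"
    using i t(3) q unfolding char by presburger
  from shift_closed_extension[OF two W this]
  obtain U where U: "U \<inter> W = {}" "shift_closed U" "card U = 3 * i"
      "(\<Sum>x\<in>U. x\<^sup>2) = of_nat i * (\<Sum>n<3. (of_nat n)\<^sup>2)"
    unfolding char by blast
  have disj: "S \<inter> U = {}" using SW U(1) by blast
  have "(\<Sum>n<3. (of_nat n)\<^sup>2) = (5 :: 'a)" by (simp add: numeral_3_eq_3 lessThan_Suc)
  also have "\<dots> = 2 + 3" by simp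
  also have "\<dots> = 2" unfolding three by simp
  finally have U4: "(\<Sum>x\<in>U. x\<^sup>2) = of_nat i * 2" unfolding U(4) by simp
  have "card (S \<union> U) = t" using disj S(1) U(3) i by (simp add: card_Un_disjoint)
  moreover have "qval 0 (S \<union> U) = qval 0 S + of_nat i * 2"
    using disj shift_closed_sum_eq_0[OF two U(2)]
    by (simp add: qval_def sum.union_disjoint U4)
  ultimately show ?thesis using S(2) by (intro exI[of _ "S \<union> U"]) simp
qed

section \<open>All values are attained\<close>

lemma qval_surj:
  fixes a c :: "'a :: {field, finite}"
  assumes two: "(2 :: 'a) \<noteq> 0" and q: "5 < CARD('a)" and t: "3 \<le> t" "t \<le> CARD('a) - 2"
  shows "\<exists>S. card S = t \<and> qval a S = c"
proof -
  have odd: "odd CARD('a)" using card_nonzero_squares[OF two] by simp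
  consider (large) "CARD('a) \<le> 2 * t" | (zero) "of_nat t = (0 :: 'a)"
    | (minus_1) "2 * t < CARD('a)" "of_nat t + 1 = (0 :: 'a)"
    | (generic) "2 * t < CARD('a)" "of_nat t \<noteq> (0 :: 'a)" "of_nat t + 1 \<noteq> (0 :: 'a)"
    by linarith
  then show ?thesis
  proof cases
    case large
    then show ?thesis using t q odd by (intro qval_large two) auto
  next
    case zero
    then show ?thesis using t q by (intro qval_card_eq_0 two) auto
  next
    case minus_1
    \<comment> \<open>Otherwise \<open>2 * t + 1 = 0\<close> in the field, while
      \<open>t = -1\<close> makes it -1.\<close>
    have "2 * t + 1 \<noteq> CARD('a)"
    proof
      assume "2 * t + 1 = CARD('a)"
      then have "of_nat (2 * t + 1) = (0 :: 'a)" using of_nat_CARD_eq_0[where 'a = 'a] by (simp only:)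
      then have "2 * (of_nat t + 1) = (1 :: 'a)" by (simp add: algebra_simps add_eq_0_iff)
      then show False using minus_1 by simp
    qed
    moreover have "t = 3 \<Longrightarrow> False"
    proof -
      assume "t = 3"
      then have "(2 :: 'a) * 2 = 0" using minus_1(2) by simp
      then show False using two by (metis no_zero_divisors)
    qed
    ultimately have t': "4 \<le> t" "2 * t + 1 < CARD('a)" using t(1) minus_1(1) by force+
    show ?thesis
    proof (cases "a = 0")
      case False
      then show ?thesis using minus_1 by (intro qval_card_eq_minus_1 two) auto
    next
      case True
      consider "(3 :: 'a) = 0" | "(3 :: 'a) \<noteq> 0" "c = 0" | "c \<noteq> 0" by blast
      then show ?thesis
        using qval_0_char_3[OF two _ minus_1(2) t(1) minus_1(1)] qval_0_zero[OF two _ minus_1(2)]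
          qval_0_nonzero[OF two t'] minus_1(1) True by cases auto
    qed
  next
    case generic
    define w where "w = a / (of_nat t + 1)"
    have a: "a = w * (of_nat t + 1)" using generic by (simp add: w_def)
    show ?thesis
    proof (cases "4 \<le> t \<or> c \<noteq> (of_nat t + 1) * w\<^sup>2")
      case True
      then show ?thesis using t generic a by (intro qval_generic two) auto
    next
      case False
      \<comment> \<open>Only the degenerate value for \<open>t = 3\<close> is left; \<open>t\<close>
        being nonzero in the field then excludes characteristic 3.\<close>
      then have t3: "t = 3" and c: "c = (of_nat t + 1) * w\<^sup>2" using t by auto
      have "(3 :: 'a) \<noteq> 0" using generic(2) t3 by simp
      moreover have "7 \<le> CARD('a)" using q odd by presburger
      ultimately show ?thesis
        using qval_three[OF two, where a = a and w = w] a c unfolding t3 by blast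
    qed
  qed
qed

theorem theorem4p2:
  fixes a b :: "'a :: {field, finite}" and t :: nat
  assumes "odd CHAR('a)"
    and "CARD('a) > 5"
    and "3 \<le> t" and "t \<le> CARD('a) - 2"
  shows "\<exists>X :: nat \<Rightarrow> 'a. inj_on X {1..t} \<and>
           b = (\<Sum>(i, j) \<in> {(i, j). 1 \<le> i \<and> i < j \<and> j \<le> t}. X i * X j)
             + (\<Sum>i = 1..t. (X i)\<^sup>2) - a * (\<Sum>i = 1..t. X i)"
proof -
  have two: "(2 :: 'a) \<noteq> 0"
  proof
    assume "(2 :: 'a) = 0"
    then have "of_nat 2 = (0 :: 'a)" by simp
    then have "CHAR('a) dvd 2" by (simp only: of_nat_eq_0_iff_char_dvd)
    then show False
      using assms(1) CHAR_not_1'[where 'a = 'a] two_is_prime_nat by (auto simp: prime_nat_iff)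
  qed
  obtain S where "card S = t" "qval a S = 2 * b + a\<^sup>2"
    using qval_surj[OF two assms(2-4)] by blast
  then show ?thesis by (rule qval_imp_representation[OF two])
qed

end
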